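(* Let $n\ge 3$ be an integer and let $D_{2n}=\langle a,b : a^n=b^2=1,\ bab^{-1}=a^{-1}\rangle$ be the dihedral group. Then \[ \mathrm{OSCom}(D_{2n})\cong\begin{cases}K_{2n}, & \text{if } n \text{ is even},\\ K_1\vee(K_{n-1}\sqcup K_n), & \text{if } n \text{ is odd}.\end{cases} \]
   Context: For a finite group $G$, the order super commuting graph $\mathrm{OSCom}(G)$ is the simple graph with vertex set $G$ in which two distinct vertices $g,h$ are adjacent if and only if either $g$ and $h$ have the same order, or there exist $g',h'\in G$ such that $g'$ has the same order as $g$, $h'$ has the same order as $h$, and $g'h'=h'g'$. $K_r$ is the complete graph on $r$ vertices, $\sqcup$ is disjoint union of graphs, and $\vee$ is the join of graphs (disjoint union together with all edges between the two vertex sets). *)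

theory Defs
  imports
    "HOL-Algebra.Multiplicative_Group"
    "Graph_Theory.Graph_Theory"
begin

section \<open>Group presentations\<close>

text \<open>
  A word is a list of letters \<open>(x, e)\<close>, where \<open>(x, True)\<close> stands for the generator \<open>x\<close> and
  \<open>(x, False)\<close> for its formal inverse. A relation \<open>u = v\<close> is a pair \<open>(u, v)\<close> of words. The group
  presented by the relations \<open>R\<close> (on all elements of the type \<open>'x\<close> as generators) consists of the
  classes of words modulo the least congruence that contains \<open>R\<close> and in which formal inverses cancel.
\<close>

type_synonym 'x gword = "('x \<times> bool) list"

inductive word_eq :: "('x gword \<times> 'x gword) set \<Rightarrow> 'x gword \<Rightarrow> 'x gword \<Rightarrow> bool"
  for R where
    relation: "(u, v) \<in> R \<Longrightarrow> word_eq R u v"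
  | cancel: "word_eq R [(x, e), (x, \<not> e)] []"
  | refl: "word_eq R u u"
  | sym: "word_eq R u v \<Longrightarrow> word_eq R v u"
  | trans: "word_eq R u v \<Longrightarrow> word_eq R v w \<Longrightarrow> word_eq R u w"
  | append: "word_eq R u u' \<Longrightarrow> word_eq R v v' \<Longrightarrow> word_eq R (u @ v) (u' @ v')"

definition word_class :: "('x gword \<times> 'x gword) set \<Rightarrow> 'x gword \<Rightarrow> 'x gword set" where
  "word_class R u = {v. word_eq R u v}"

definition presented_group :: "('x gword \<times> 'x gword) set \<Rightarrow> 'x gword set monoid" where
  "presented_group R =
    \<lparr> carrier = range (word_class R),
      monoid.mult = (\<lambda>X Y. {w. \<exists>u \<in> X. \<exists>v \<in> Y. word_eq R (u @ v) w}),
      one = word_class R [] \<rparr>"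

lemma word_class_eq_iff: "word_class R u = word_class R v \<longleftrightarrow> word_eq R u v"
  unfolding word_class_def by (blast intro: word_eq.refl word_eq.sym word_eq.trans)

lemma presented_group_mult:
  "word_class R u \<otimes>\<^bsub>presented_group R\<^esub> word_class R v = word_class R (u @ v)"
  unfolding presented_group_def word_class_def
  by (auto intro: word_eq.refl word_eq.sym word_eq.trans word_eq.append)

lemma word_eq_inverse: "\<exists>v. word_eq R (v @ u) []"
proof (induction u)
  case Nil
  show ?case by (auto intro: word_eq.refl exI[of _ "[]"])
next
  case (Cons l u)
  then obtain v where v: "word_eq R (v @ u) []" by blast
  obtain x e where l: "l = (x, e)" by force
  have "word_eq R ([(x, \<not> e)] @ [(x, e)]) []"
    using word_eq.cancel[of R x "\<not> e"] by simp
  then have "word_eq R (v @ ([(x, \<not> e)] @ [(x, e)]) @ u) (v @ [] @ u)"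
    by (intro word_eq.append word_eq.refl)
  with v have "word_eq R ((v @ [(x, \<not> e)]) @ l # u) []"
    by (auto simp: l intro: word_eq.trans)
  then show ?case by blast
qed

lemma group_presented_group: "group (presented_group R)"
proof -
  have carrier: "carrier (presented_group R) = range (word_class R)"
    and one: "\<one>\<^bsub>presented_group R\<^esub> = word_class R []"
    by (simp_all add: presented_group_def)
  note simps = carrier one presented_group_mult
  have inverse: "\<exists>v. word_class R (v @ u) = word_class R []" for u
    using word_eq_inverse by (simp add: word_class_eq_iff)
  show ?thesis
    by (rule groupI) (auto simp: simps inverse)
qed

section \<open>Dihedral groups\<close>

datatype dihedral_gen = Rot | Refl

abbreviation (input) letter :: "'x \<Rightarrow> 'x gword" where
  "letter x \<equiv> [(x, True)]"

abbreviation (input) letter_inv :: "'x \<Rightarrow> 'x gword" where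
  "letter_inv x \<equiv> [(x, False)]"

text \<open>The dihedral group of order \<open>2 * n\<close>, with \<open>a = Rot\<close> and \<open>b = Refl\<close>.\<close>

definition dihedral_group :: "nat \<Rightarrow> dihedral_gen gword set monoid" where
  "dihedral_group n = presented_group
    {(replicate n (Rot, True), []),
     (letter Refl @ letter Refl, []),
     (letter Refl @ letter Rot @ letter_inv Refl, letter_inv Rot)}"


section \<open>Graphs\<close>

text \<open>
  A simple graph is represented as a symmetric loop-free \<^typ>\<open>'a pair_pre_digraph\<close>: an edge between
  \<open>u\<close> and \<open>v\<close> is the pair of arcs \<open>(u, v)\<close>, \<open>(v, u)\<close>.
\<close>

definition complete_graph :: "nat \<Rightarrow> nat pair_pre_digraph" where
  "complete_graph r = \<lparr> pverts = {..<r}, parcs = {(u, v). u < r \<and> v < r \<and> u \<noteq> v} \<rparr>"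

lemma complete_digraph_complete_graph: "complete_digraph r (with_proj (complete_graph r))"
  by (auto simp: complete_digraph_pair_def complete_graph_def)

definition disjoint_union_graph ::
    "'a pair_pre_digraph \<Rightarrow> 'b pair_pre_digraph \<Rightarrow> ('a + 'b) pair_pre_digraph" where
  "disjoint_union_graph G H =
    \<lparr> pverts = pverts G <+> pverts H,
      parcs = {(Inl u, Inl v) | u v. (u, v) \<in> parcs G} \<union> {(Inr u, Inr v) | u v. (u, v) \<in> parcs H} \<rparr>"

definition join_graph ::
    "'a pair_pre_digraph \<Rightarrow> 'b pair_pre_digraph \<Rightarrow> ('a + 'b) pair_pre_digraph" where
  "join_graph G H =
    \<lparr> pverts = pverts (disjoint_union_graph G H),
      parcs = parcs (disjoint_union_graph G H)
        \<union> {(Inl u, Inr v) | u v. u \<in> pverts G \<and> v \<in> pverts H}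
        \<union> {(Inr v, Inl u) | u v. u \<in> pverts G \<and> v \<in> pverts H} \<rparr>"

definition OSCom :: "('a, 'm) monoid_scheme \<Rightarrow> 'a pair_pre_digraph" where
  "OSCom G =
    \<lparr> pverts = carrier G,
      parcs = {(g, h). g \<in> carrier G \<and> h \<in> carrier G \<and> g \<noteq> h \<and>
        (group.ord G g = group.ord G h \<or>
         (\<exists>g' \<in> carrier G. \<exists>h' \<in> carrier G.
            group.ord G g' = group.ord G g \<and> group.ord G h' = group.ord G h \<and>
            g' \<otimes>\<^bsub>G\<^esub> h' = h' \<otimes>\<^bsub>G\<^esub> g'))} \<rparr>"

end

theory Submission
  imports Defs
begin

text \<open>
  The graph only sees the orders of the elements and which orders are realised by commuting
  pairs. In the dihedral group of order \<open>2 * n\<close> all rotations commute with each other and all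
  reflections have order 2, so everything depends on whether some rotation also has order 2.

  If \<open>n\<close> is even, the half turn has order 2. Hence every element has the order of some rotation,
  and any two elements can be replaced by commuting ones: the graph is complete
  (\<open>OSCom_dihedral_model_even\<close>).

  If \<open>n\<close> is odd, the elements of order 2 are exactly the reflections, because \<open>2 * i \<equiv> 0\<close> modulo
  \<open>n\<close> forces \<open>i \<equiv> 0\<close>. So an element with the order of a reflection is a reflection, and one with
  the order of a nontrivial rotation is a nontrivial rotation; the same congruence shows that these
  two never commute. The \<open>n - 1\<close> nontrivial rotations and the \<open>n\<close> reflections therefore form two
  cliques without edges between them, and the identity is adjacent to everything
  (\<open>OSCom_dihedral_model_odd\<close>).

  These computations need explicit elements, whereas the dihedral group is given by a presentation.
  The bridge is an isomorphism with the pairs \<open>(i, s)\<close> that stand for \<open>a\<^sup>i b\<^sup>s\<close>, with \<open>i\<close> a residue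
  modulo \<open>n\<close> (\<open>dihedral_group_iso_model\<close>). That the elements \<open>a\<^sup>i b\<^sup>s\<close> exhaust the group follows
  from the relations; that they are distinct follows by von Dyck's argument, since words equal in
  the presented group have equal values in every group where the relations hold
  (\<open>word_eval_cong\<close>).
\<close>

section \<open>Isomorphisms of simple graphs\<close>

text \<open>
  Arcs of a pair digraph are determined by their ends, so a bijection of vertices that preserves
  adjacency induces the map on arcs. Isomorphism is an equality with the relabelled digraph,
  head and tail functions included, and \<open>map_prod f f\<close> makes these the two projections again.
\<close>

lemma digraph_iso_pairI:
  assumes bij: "bij_betw f (pverts G) (pverts H)"
    and G: "parcs G \<subseteq> pverts G \<times> pverts G" and H: "parcs H \<subseteq> pverts H \<times> pverts H"
    and adj: "\<And>u v. u \<in> pverts G \<Longrightarrow> v \<in> pverts G \<Longrightarrow>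
      (u, v) \<in> parcs G \<longleftrightarrow> (f u, f v) \<in> parcs H"
  shows "digraph_iso (with_proj G) (with_proj H)"
proof -
  let ?hom = "\<lparr>iso_verts = f, iso_arcs = map_prod f f, iso_head = snd, iso_tail = fst\<rparr>"
  have inj: "inj_on f (pverts G)" and img: "f ` pverts G = pverts H"
    using bij by (auto simp: bij_betw_def)
  have "wf_digraph (with_proj G)"
    using G by unfold_locales auto
  moreover have "inj_on (map_prod f f) (parcs G)"
    using G map_prod_inj_on[OF inj inj] inj_on_subset by blast
  ultimately have iso: "pre_digraph.digraph_isomorphism (with_proj G) ?hom"
    using inj by (simp add: pre_digraph.digraph_isomorphism_def)
  have "parcs H = map_prod f f ` parcs G"
  proof (intro subset_antisym subrelI)
    fix x y assume xy: "(x, y) \<in> parcs H"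
    then obtain u v where "u \<in> pverts G" "v \<in> pverts G" "x = f u" "y = f v"
      using H img by blast
    with xy adj show "(x, y) \<in> map_prod f f ` parcs G"
      by force
  qed (use G adj in auto)
  then have "with_proj H = app_iso ?hom (with_proj G)"
    by (simp add: app_iso_def with_proj_def img)
  with iso show ?thesis
    unfolding digraph_iso_def by blast
qed

lemma parcs_complete_graph: "(u, v) \<in> parcs (complete_graph r) \<longleftrightarrow> u < r \<and> v < r \<and> u \<noteq> v"
  by (simp add: complete_graph_def)

lemma parcs_disjoint_union_graph:
  "(Inl u, Inl u') \<in> parcs (disjoint_union_graph G H) \<longleftrightarrow> (u, u') \<in> parcs G"
  "(Inr v, Inr v') \<in> parcs (disjoint_union_graph G H) \<longleftrightarrow> (v, v') \<in> parcs H"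
  "(Inl u, Inr v) \<notin> parcs (disjoint_union_graph G H)"
  "(Inr v, Inl u) \<notin> parcs (disjoint_union_graph G H)"
  by (auto simp: disjoint_union_graph_def)

lemma parcs_join_graph:
  "(Inl u, Inl u') \<in> parcs (join_graph G H) \<longleftrightarrow> (u, u') \<in> parcs G"
  "(Inr v, Inr v') \<in> parcs (join_graph G H) \<longleftrightarrow> (v, v') \<in> parcs H"
  "(Inl u, Inr v) \<in> parcs (join_graph G H) \<longleftrightarrow> u \<in> pverts G \<and> v \<in> pverts H"
  "(Inr v, Inl u) \<in> parcs (join_graph G H) \<longleftrightarrow> u \<in> pverts G \<and> v \<in> pverts H"
  by (auto simp: join_graph_def disjoint_union_graph_def)

lemmas parcs_graph_simps =
  parcs_complete_graph parcs_disjoint_union_graph parcs_join_graph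

lemma pverts_graph_simps:
  "pverts (complete_graph r) = {..<r}"
  "pverts (disjoint_union_graph G H) = pverts G <+> pverts H"
  "pverts (join_graph G H) = pverts G <+> pverts H"
  by (simp_all add: complete_graph_def disjoint_union_graph_def join_graph_def)

lemma digraph_iso_complete_graph:
  assumes "finite (pverts G)" "card (pverts G) = r"
    and "parcs G = {(u, v). u \<in> pverts G \<and> v \<in> pverts G \<and> u \<noteq> v}"
  shows "digraph_iso (with_proj G) (with_proj (complete_graph r))"
proof -
  obtain f where f: "bij_betw f (pverts G) {0..<r}"
    using ex_bij_betw_finite_nat assms by blast
  then have "u \<in> pverts G \<Longrightarrow> f u < r" for u
    by (auto simp: bij_betw_def)
  with f show ?thesis
    by (intro digraph_iso_pairI[where f = f])
      (auto simp: complete_graph_def assms(3) atLeast0LessThan bij_betw_def dest: inj_onD)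
qed

section \<open>Invariance of the order super commuting graph under isomorphism\<close>

lemma ord_iso:
  assumes "group G" "group H" "h \<in> iso G H" "x \<in> carrier G"
  shows "group.ord H (h x) = group.ord G x"
proof -
  interpret G: group G by fact
  interpret H: group H by fact
  have hom: "h \<in> hom G H" and inj: "inj_on h (carrier G)"
    using assms by (auto simp: iso_def bij_betw_def)
  interpret group_hom G H h
    using hom by unfold_locales
  have "h x [^]\<^bsub>H\<^esub> k = \<one>\<^bsub>H\<^esub> \<longleftrightarrow> x [^]\<^bsub>G\<^esub> k = \<one>\<^bsub>G\<^esub>" for k :: nat
    using assms(4) inj by (metis G.nat_pow_closed G.one_closed hom_nat_pow hom_one inj_onD)
  with assms(4) show ?thesis
    by (subst H.ord_unique) (auto simp: G.pow_eq_id)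
qed

lemma OSCom_iso:
  assumes "group G" "group H" and h: "h \<in> iso G H"
  shows "digraph_iso (with_proj (OSCom G)) (with_proj (OSCom H))"
proof -
  have inj: "inj_on h (carrier G)" and img: "carrier H = h ` carrier G"
    and mult: "\<And>x y. x \<in> carrier G \<Longrightarrow> y \<in> carrier G \<Longrightarrow> h (x \<otimes>\<^bsub>G\<^esub> y) = h x \<otimes>\<^bsub>H\<^esub> h y"
    using h by (auto simp: iso_def bij_betw_def hom_def)
  have commute: "h x \<otimes>\<^bsub>H\<^esub> h y = h y \<otimes>\<^bsub>H\<^esub> h x \<longleftrightarrow> x \<otimes>\<^bsub>G\<^esub> y = y \<otimes>\<^bsub>G\<^esub> x"
    if "x \<in> carrier G" "y \<in> carrier G" for x y
    using that inj_onD[OF inj] monoid.m_closed[OF group.is_monoid[OF \<open>group G\<close>]]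
    by (metis mult)
  show ?thesis
    by (rule digraph_iso_pairI[where f = h])
      (use h in \<open>auto simp: OSCom_def iso_def img ord_iso[OF assms] commute inj_on_eq_iff[OF inj]\<close>)
qed

section \<open>Evaluation of words in a group\<close>

definition letter_eval :: "('a, 'm) monoid_scheme \<Rightarrow> ('x \<Rightarrow> 'a) \<Rightarrow> 'x \<times> bool \<Rightarrow> 'a" where
  "letter_eval G f l = (if snd l then f (fst l) else inv\<^bsub>G\<^esub> f (fst l))"

primrec word_eval :: "('a, 'm) monoid_scheme \<Rightarrow> ('x \<Rightarrow> 'a) \<Rightarrow> 'x gword \<Rightarrow> 'a" where
  "word_eval G f [] = \<one>\<^bsub>G\<^esub>"
| "word_eval G f (l # w) = letter_eval G f l \<otimes>\<^bsub>G\<^esub> word_eval G f w"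

context group
begin

lemma letter_eval_closed: "range f \<subseteq> carrier G \<Longrightarrow> letter_eval G f l \<in> carrier G"
  by (auto simp: letter_eval_def)

lemma word_eval_closed: "range f \<subseteq> carrier G \<Longrightarrow> word_eval G f w \<in> carrier G"
  by (induction w) (auto simp: letter_eval_closed)

lemma word_eval_append:
  "range f \<subseteq> carrier G \<Longrightarrow> word_eval G f (u @ v) = word_eval G f u \<otimes> word_eval G f v"
  by (induction u) (auto simp: letter_eval_closed word_eval_closed m_assoc)

lemma word_eval_replicate:
  assumes "range f \<subseteq> carrier G"
  shows "word_eval G f (replicate k (x, True)) = f x [^] k"
proof (induction k)
  case (Suc k)
  have "f x \<in> carrier G" using assms by blast
  then show ?case
    using Suc nat_pow_Suc2[of "f x" k] by (simp add: letter_eval_def)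
qed simp

text \<open>
  Von Dyck's theorem: evaluation is itself a congruence on words in which formal inverses cancel,
  so it contains the least such congruence as soon as it contains the relations.
\<close>

lemma word_eval_cong:
  assumes f: "range f \<subseteq> carrier G"
    and R: "\<And>u v. (u, v) \<in> R \<Longrightarrow> word_eval G f u = word_eval G f v"
    and "word_eq R u v"
  shows "word_eval G f u = word_eval G f v"
  using assms(3)
proof induction
  case (cancel x e)
  have "f x \<in> carrier G" using f by blast
  then show ?case by (auto simp: letter_eval_def)
qed (auto simp: R word_eval_append[OF f])

end

lemma word_eval_hom:
  assumes "group G" "group H" "h \<in> hom G H" "range f \<subseteq> carrier G"
  shows "h (word_eval G f w) = word_eval H (h \<circ> f) w"
proof -
  interpret G: group G by fact
  interpret H: group H by fact
  interpret group_hom G H h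
    using assms by unfold_locales auto
  have "f x \<in> carrier G" for x using assms by blast
  then have "h (letter_eval G f l) = letter_eval H (h \<circ> f) l" for l
    by (simp add: letter_eval_def)
  then show ?thesis
    by (induction w) (simp_all add: G.letter_eval_closed G.word_eval_closed assms(4))
qed

text \<open>
  Evaluating a word at the classes of the generators gives its own class. This lets calculations
  with word classes be done with the laws of the presented group instead of rewriting of words.
\<close>

lemma word_eval_presented_group:
  "word_eval (presented_group R) (\<lambda>x. word_class R (letter x)) w = word_class R w"
proof -
  interpret P: group "presented_group R"
    by (rule group_presented_group)
  have closed: "word_class R u \<in> carrier (presented_group R)" for u
    by (simp add: presented_group_def)
  have one: "\<one>\<^bsub>presented_group R\<^esub> = word_class R []"
    by (simp add: presented_group_def)
  have "inv\<^bsub>presented_group R\<^esub> word_class R (letter x) = word_class R (letter_inv x)" for x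
  proof (rule P.inv_equality)
    show "word_class R (letter_inv x) \<otimes>\<^bsub>presented_group R\<^esub> word_class R (letter x)
      = \<one>\<^bsub>presented_group R\<^esub>"
      using word_eq.cancel[of R x False] by (simp add: one presented_group_mult word_class_eq_iff)
  qed (rule closed)+
  then have "letter_eval (presented_group R) (\<lambda>x. word_class R (letter x)) l = word_class R [l]" for l
    by (cases l) (auto simp: letter_eval_def)
  then show ?thesis
    by (induction w) (simp_all add: one presented_group_mult)
qed

section \<open>A concrete model of the dihedral group\<close>

text \<open>
  The pair \<open>(i, s)\<close> is the normal form \<open>a\<^sup>i b\<^sup>s\<close>: a rotation if \<open>s\<close> is false and a reflection
  otherwise. The sign of the second summand in the product comes from \<open>b a\<^sup>j = a\<^sup>-\<^sup>j b\<close>.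
\<close>

definition dihedral_model :: "nat \<Rightarrow> (int \<times> bool) monoid" where
  "dihedral_model n =
    \<lparr> carrier = {0..<int n} \<times> UNIV,
      monoid.mult = (\<lambda>(i, s) (j, t). ((if s then i - j else i + j) mod int n, s \<noteq> t)),
      one = (0, False) \<rparr>"

lemma carrier_dihedral_model: "carrier (dihedral_model n) = {0..<int n} \<times> UNIV"
  and one_dihedral_model: "\<one>\<^bsub>dihedral_model n\<^esub> = (0, False)"
  and mult_dihedral_model: "(i, s) \<otimes>\<^bsub>dihedral_model n\<^esub> (j, t) =
    ((if s then i - j else i + j) mod int n, s \<noteq> t)"
  by (simp_all add: dihedral_model_def)

lemmas dihedral_model_simps = carrier_dihedral_model one_dihedral_model mult_dihedral_model

lemma group_dihedral_model:
  assumes "n > 0"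
  shows "group (dihedral_model n)"
proof (rule groupI)
  fix x assume x: "x \<in> carrier (dihedral_model n)"
  obtain i s where "x = (i, s)" by force
  then show "\<exists>y\<in>carrier (dihedral_model n). y \<otimes>\<^bsub>dihedral_model n\<^esub> x = \<one>\<^bsub>dihedral_model n\<^esub>"
    using x assms by (intro bexI[of _ "if s then x else (- i mod int n, False)"])
      (auto simp: dihedral_model_simps mod_simps)
next
  fix x y z
  show "x \<otimes>\<^bsub>dihedral_model n\<^esub> y \<otimes>\<^bsub>dihedral_model n\<^esub> z
    = x \<otimes>\<^bsub>dihedral_model n\<^esub> (y \<otimes>\<^bsub>dihedral_model n\<^esub> z)"
    by (cases x; cases y; cases z) (auto simp: dihedral_model_simps mod_simps algebra_simps)
qed (use assms in \<open>auto simp: dihedral_model_simps\<close>)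

lemma rotation_pow:
  "i \<in> {0..<int n} \<Longrightarrow>
    (i, False) [^]\<^bsub>dihedral_model n\<^esub> k = (i * int k mod int n, False)"
  by (induction k) (auto simp: dihedral_model_simps mod_simps algebra_simps)

text \<open>
  Conjugation by \<open>b\<close> is an automorphism, so it inverts every power of \<open>a\<close> once it inverts \<open>a\<close>.
  This is the rule that moves \<open>b\<close> to the right in normal forms.
\<close>

lemma (in group) inverted_int_pow:
  assumes ab: "a \<in> carrier G" "b \<in> carrier G" and conj: "b \<otimes> a \<otimes> inv b = inv a"
  shows "b \<otimes> a [^] (i :: int) = a [^] (- i) \<otimes> b"
proof -
  have ba: "b \<otimes> a = inv a \<otimes> b"
    using ab conj by (metis inv_closed inv_solve_right m_closed)
  have nat: "b \<otimes> a [^] k = inv a [^] k \<otimes> b" for k :: nat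
  proof (induction k)
    case (Suc k)
    have "b \<otimes> a [^] Suc k = inv a [^] k \<otimes> (b \<otimes> a)"
      using ab Suc by (simp flip: m_assoc)
    then show ?case
      using ab by (simp add: ba m_assoc)
  qed (use ab in simp)
  show ?thesis
  proof (cases i rule: int_cases2)
    case (nonneg k)
    then show ?thesis
      using ab nat[of k] by (simp add: int_pow_int int_pow_neg nat_pow_inv)
  next
    case (nonpos k)
    have "a [^] k \<otimes> b = a [^] k \<otimes> (b \<otimes> a [^] k) \<otimes> inv (a [^] k)"
      using ab by (simp add: m_assoc)
    also have "\<dots> = b \<otimes> inv (a [^] k)"
      using ab by (simp add: nat nat_pow_inv flip: m_assoc)
    finally show ?thesis
      using nonpos ab by (simp add: int_pow_int int_pow_neg)
  qed
qed

text \<open>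
  The three relations are exactly what makes the product of two normal forms agree with the product
  in the model: \<open>a\<^sup>n = 1\<close> allows exponents to be reduced modulo \<open>n\<close>, the
  conjugation relation brings the powers of \<open>b\<close> together, and \<open>b\<^sup>2 = 1\<close> merges them.
\<close>

lemma (in group) dihedral_model_hom:
  assumes ab: "a \<in> carrier G" "b \<in> carrier G"
    and an: "a [^] n = \<one>" and bb: "b \<otimes> b = \<one>" and conj: "b \<otimes> a \<otimes> inv b = inv a"
  shows "(\<lambda>(i, s). a [^] i \<otimes> (if s then b else \<one>)) \<in> hom (dihedral_model n) G"
proof -
  have pow_mod: "a [^] (i mod int n) = a [^] i" for i :: int
  proof -
    have "int (ord a) dvd i - i mod int n"
      using an ab pow_eq_id by (metis dvd_minus_mod dvd_trans int_dvd_int_iff)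
    then show ?thesis
      using int_pow_eq[OF ab(1)] by simp
  qed
  have "a [^] (i - j) = a [^] i \<otimes> a [^] (- j)" for i j :: int
    using ab int_pow_mult[of a i "- j"] by simp
  moreover have "a [^] i \<otimes> b \<otimes> (a [^] j \<otimes> c) = a [^] i \<otimes> a [^] (- j) \<otimes> (b \<otimes> c)"
    if "c \<in> carrier G" for i j :: int and c
    using ab that inverted_int_pow[OF ab conj, of j]
    by (metis int_pow_closed m_assoc m_closed)
  ultimately show ?thesis
    using ab
    by (auto simp: hom_def dihedral_model_simps pow_mod bb m_assoc int_pow_mult)
qed

abbreviation dihedral_rels where
  "dihedral_rels n \<equiv>
    {(replicate n (Rot, True), []),
     (letter Refl @ letter Refl, []),
     (letter Refl @ letter Rot @ letter_inv Refl, letter_inv Rot)}"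

text \<open>The exponent is reduced modulo \<open>n\<close> because for \<open>n = 1\<close> the rotation \<open>a\<close> is trivial.\<close>

primrec model_gen :: "nat \<Rightarrow> dihedral_gen \<Rightarrow> int \<times> bool" where
  "model_gen n Rot = (1 mod int n, False)"
| "model_gen n Refl = (0, True)"

lemma range_model_gen:
  assumes "n > 0"
  shows "range (model_gen n) \<subseteq> carrier (dihedral_model n)"
proof (rule image_subsetI)
  show "model_gen n x \<in> carrier (dihedral_model n)" for x
    using assms by (cases x) (auto simp: carrier_dihedral_model)
qed

lemma model_gen_rels:
  assumes n: "n > 0" and "(u, v) \<in> dihedral_rels n"
  shows "word_eval (dihedral_model n) (model_gen n) u = word_eval (dihedral_model n) (model_gen n) v"
proof -
  interpret D: group "dihedral_model n"
    by (rule group_dihedral_model[OF n])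
  have rot: "inv\<^bsub>dihedral_model n\<^esub> (1 mod int n, False) = (- 1 mod int n, False)"
    using n by (intro D.inv_equality) (auto simp: dihedral_model_simps mod_simps)
  have refl: "inv\<^bsub>dihedral_model n\<^esub> (0, True) = (0, True)"
    using n by (intro D.inv_equality) (auto simp: dihedral_model_simps)
  have pow: "word_eval (dihedral_model n) (model_gen n) (replicate n (Rot, True)) = (0, False)"
    using n by (subst D.word_eval_replicate[OF range_model_gen[OF n]])
      (simp add: rotation_pow mod_simps)
  from assms(2) show ?thesis
    by (auto simp: pow letter_eval_def rot refl dihedral_model_simps mod_simps)
qed

lemma model_gen_generates:
  assumes n: "n > 0" and x: "x \<in> carrier (dihedral_model n)"
  obtains w where "word_eval (dihedral_model n) (model_gen n) w = x"
proof -
  interpret D: group "dihedral_model n"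
    by (rule group_dihedral_model[OF n])
  obtain i s where xis: "x = (i, s)" by force
  let ?w = "replicate (nat i) (Rot, True) @ (if s then letter Refl else [])"
  have "word_eval (dihedral_model n) (model_gen n) ?w = x"
    using n x rotation_pow[of "1 mod int n" n "nat i"]
    by (simp add: D.word_eval_append[OF range_model_gen[OF n]]
        D.word_eval_replicate[OF range_model_gen[OF n]] letter_eval_def
        dihedral_model_simps xis mod_simps)
  then show ?thesis by (rule that)
qed

text \<open>
  The map \<open>h\<close> sends a normal form to its value in the presented group. Composing it with the
  evaluation of words in the model gives the class map, because both are evaluations and agree on
  the generators. Hence \<open>h\<close> is onto. It is injective because every element of the model is the value
  of a word, and by von Dyck words in the same class have the same value in the model.
\<close>

lemma dihedral_group_iso_model:
  assumes n: "n > 0"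
  shows "\<exists>h. h \<in> iso (dihedral_model n) (dihedral_group n)"
proof -
  let ?D = "dihedral_model n" and ?P = "dihedral_group n" and ?R = "dihedral_rels n"
  interpret D: group ?D
    by (rule group_dihedral_model[OF n])
  interpret P: group ?P
    unfolding dihedral_group_def by (rule group_presented_group)
  define c where "c = word_class ?R"
  have carrier: "carrier ?P = range c" and one: "\<one>\<^bsub>?P\<^esub> = c []"
    by (simp_all add: dihedral_group_def presented_group_def c_def)
  have closed: "c w \<in> carrier ?P" for w
    by (simp add: carrier)
  have eval: "word_eval ?P (\<lambda>x. c (letter x)) w = c w" for w
    unfolding dihedral_group_def c_def by (rule word_eval_presented_group)
  have rel: "c u = c v" if "(u, v) \<in> ?R" for u v
    using word_eq.relation[OF that] by (simp add: c_def word_class_eq_iff)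
  have mult: "c u \<otimes>\<^bsub>?P\<^esub> c v = c (u @ v)" for u v
    unfolding dihedral_group_def c_def by (rule presented_group_mult)
  have inv: "inv\<^bsub>?P\<^esub> c (letter x) = c (letter_inv x)" for x
    using eval[of "letter_inv x"] closed by (simp add: letter_eval_def)
  define h where "h = (\<lambda>(i :: int, s). c (letter Rot) [^]\<^bsub>?P\<^esub> i \<otimes>\<^bsub>?P\<^esub>
    (if s then c (letter Refl) else \<one>\<^bsub>?P\<^esub>))"
  have "c (letter Rot) [^]\<^bsub>?P\<^esub> n = c (replicate n (Rot, True))"
    using eval[of "replicate n (Rot, True)"] P.word_eval_replicate[of "\<lambda>x. c (letter x)" n Rot] closed
    by auto
  then have an: "c (letter Rot) [^]\<^bsub>?P\<^esub> n = \<one>\<^bsub>?P\<^esub>"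
    using rel[of "replicate n (Rot, True)" "[]"] by (simp add: one)
  have bb: "c (letter Refl) \<otimes>\<^bsub>?P\<^esub> c (letter Refl) = \<one>\<^bsub>?P\<^esub>"
    using rel[of "letter Refl @ letter Refl" "[]"] by (simp add: one mult)
  have bab: "c (letter Refl) \<otimes>\<^bsub>?P\<^esub> c (letter Rot) \<otimes>\<^bsub>?P\<^esub> inv\<^bsub>?P\<^esub> c (letter Refl)
      = inv\<^bsub>?P\<^esub> c (letter Rot)"
    using rel[of "letter Refl @ letter Rot @ letter_inv Refl" "letter_inv Rot"]
    by (simp add: inv mult)
  have hom: "h \<in> hom ?D ?P"
    unfolding h_def by (rule P.dihedral_model_hom[OF closed closed an bb bab])
  have pow1: "c (letter Rot) [^]\<^bsub>?P\<^esub> (1 mod int n) = c (letter Rot)"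
  proof (cases "n = 1")
    case True
    with an P.l_one[OF closed] show ?thesis by simp
  next
    case False
    with n closed show ?thesis by simp
  qed
  have "(h \<circ> model_gen n) x = c (letter x)" for x
    using closed by (cases x) (simp_all add: h_def pow1)
  then have gen: "h \<circ> model_gen n = (\<lambda>x. c (letter x))"
    by blast
  have h_eval: "h (word_eval ?D (model_gen n) w) = c w" for w
    using word_eval_hom[OF D.is_group P.is_group hom range_model_gen[OF n]] by (simp add: gen eval)
  have "inj_on h (carrier ?D)"
  proof (rule inj_onI)
    fix x y assume xy: "x \<in> carrier ?D" "y \<in> carrier ?D" "h x = h y"
    obtain u v where uv: "word_eval ?D (model_gen n) u = x" "word_eval ?D (model_gen n) v = y"
      using xy model_gen_generates[OF n] by metis
    with xy h_eval have "c u = c v" by metis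
    then have "word_eq ?R u v"
      by (simp add: c_def word_class_eq_iff)
    then show "x = y"
      using D.word_eval_cong[OF range_model_gen[OF n] model_gen_rels[OF n]] uv by blast
  qed
  moreover have "h ` carrier ?D = carrier ?P"
  proof
    show "carrier ?P \<subseteq> h ` carrier ?D"
      unfolding carrier using h_eval D.word_eval_closed[OF range_model_gen[OF n]]
      by (metis image_subsetI rev_image_eqI)
  qed (use hom in \<open>auto simp: hom_def\<close>)
  ultimately have "h \<in> iso ?D ?P"
    using hom by (auto simp: iso_def bij_betw_def)
  then show ?thesis by blast
qed

section \<open>Orders and adjacency in the model\<close>

lemma (in group) ord_eq_2:
  assumes "x \<in> carrier G"
  shows "ord x = 2 \<longleftrightarrow> x \<noteq> \<one> \<and> x \<otimes> x = \<one>"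
proof -
  have "x \<otimes> x = \<one> \<longleftrightarrow> ord x dvd 2"
    using pow_eq_id[OF assms, of 2] assms by (simp add: numeral_2_eq_2)
  moreover have "ord x dvd 2 \<longleftrightarrow> ord x = 1 \<or> ord x = 2"
    using dvd_imp_le[of "ord x" 2] by (auto simp: le_Suc_eq numeral_2_eq_2)
  ultimately show ?thesis
    using ord_eq_1[OF assms] by auto
qed

lemma ord_reflection:
  assumes "n > 0" "i \<in> {0..<int n}"
  shows "group.ord (dihedral_model n) (i, True) = 2"
proof -
  interpret D: group "dihedral_model n"
    using assms by (simp add: group_dihedral_model)
  show ?thesis
    using assms by (subst D.ord_eq_2) (auto simp: dihedral_model_simps)
qed

text \<open>
  Every element has the order of some rotation, and rotations commute.
\<close>

lemma OSCom_dihedral_model_even: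
  assumes "n > 0" "even n"
  shows "parcs (OSCom (dihedral_model n)) =
    {(x, y). x \<in> carrier (dihedral_model n) \<and> y \<in> carrier (dihedral_model n) \<and> x \<noteq> y}"
proof -
  let ?D = "dihedral_model n"
  interpret D: group ?D
    using assms by (simp add: group_dihedral_model)
  have half: "group.ord ?D (int n div 2, False) = 2"
    using assms by (subst D.ord_eq_2) (auto simp: dihedral_model_simps elim!: evenE)
  \<comment> \<open>The half turn stands in for all reflections.\<close>
  have rot: "\<exists>j. (j, False) \<in> carrier ?D \<and> D.ord (j, False) = D.ord x" if "x \<in> carrier ?D" for x
  proof (cases x)
    case (Pair i s)
    show ?thesis
    proof (cases s)
      case True
      with Pair that assms half show ?thesis
        by (intro exI[of _ "int n div 2"]) (auto simp: ord_reflection carrier_dihedral_model)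
    qed (use Pair that in auto)
  qed
  have "\<exists>x'\<in>carrier ?D. \<exists>y'\<in>carrier ?D. D.ord x' = D.ord x \<and> D.ord y' = D.ord y \<and>
      x' \<otimes>\<^bsub>?D\<^esub> y' = y' \<otimes>\<^bsub>?D\<^esub> x'" if xy: "x \<in> carrier ?D" "y \<in> carrier ?D" for x y
  proof -
    obtain i j where "(i, False) \<in> carrier ?D" "D.ord (i, False) = D.ord x"
      "(j, False) \<in> carrier ?D" "D.ord (j, False) = D.ord y"
      using rot xy by metis
    moreover have "(i, False) \<otimes>\<^bsub>?D\<^esub> (j, False) = (j, False) \<otimes>\<^bsub>?D\<^esub> (i, False)"
      by (simp add: mult_dihedral_model add.commute)
    ultimately show ?thesis by blast
  qed
  then show ?thesis
    by (auto simp: OSCom_def)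
qed

lemma double_mod_odd_eq_0:
  assumes "odd n" "i \<in> {0..<int n}" "(i + i) mod int n = 0"
  shows "i = 0"
proof -
  have "int n dvd 2 * i"
    using assms(3) by (simp add: mod_eq_0_iff_dvd flip: mult_2)
  moreover have "coprime (int n) 2"
    using assms(1) by simp
  ultimately have "int n dvd i"
    using coprime_dvd_mult_right_iff by blast
  with assms(2) show ?thesis
    using zdvd_imp_le[of "int n" i] by force
qed

text \<open>
  Replacing an element by one of the same order cannot turn a nontrivial rotation into the identity
  or a reflection, nor a reflection into a rotation. Adjacency between the two kinds would
  therefore need a nontrivial rotation commuting with a reflection, that is, equal to its own
  inverse, which is impossible as no rotation has even order.
\<close>

lemma OSCom_dihedral_model_odd:
  assumes "odd n"
  shows "parcs (OSCom (dihedral_model n)) =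
    {(x, y). x \<in> carrier (dihedral_model n) \<and> y \<in> carrier (dihedral_model n) \<and> x \<noteq> y \<and>
      (x = (0, False) \<or> y = (0, False) \<or> snd x = snd y)}"
proof -
  let ?D = "dihedral_model n"
  have n: "n > 0" using assms by (simp add: odd_pos)
  interpret D: group ?D
    using n by (simp add: group_dihedral_model)
  have ord2: "D.ord x = 2 \<longleftrightarrow> snd x" if "x \<in> carrier ?D" for x
  proof -
    obtain i s where x: "x = (i, s)" by force
    show ?thesis
    proof (cases s)
      case True
      with x that ord_reflection[OF n] show ?thesis
        by (simp add: carrier_dihedral_model)
    next
      case False
      have "i \<noteq> 0 \<Longrightarrow> (i + i) mod int n \<noteq> 0"
        using double_mod_odd_eq_0[OF assms, of i] that by (auto simp: x carrier_dihedral_model)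
      with False show ?thesis
        unfolding D.ord_eq_2[OF that] by (auto simp: x one_dihedral_model mult_dihedral_model)
    qed
  qed
  have ord1: "D.ord x = 1 \<longleftrightarrow> x = (0, False)" if "x \<in> carrier ?D" for x
    using D.ord_eq_1[OF that] by (simp add: one_dihedral_model)
  have comm_same: "\<exists>x'\<in>carrier ?D. \<exists>y'\<in>carrier ?D. D.ord x' = D.ord x \<and> D.ord y' = D.ord y \<and>
      x' \<otimes>\<^bsub>?D\<^esub> y' = y' \<otimes>\<^bsub>?D\<^esub> x'"
    if "x \<in> carrier ?D" "y \<in> carrier ?D" "x = (0, False) \<or> y = (0, False) \<or> \<not> snd x \<and> \<not> snd y" for x y
  proof -
    obtain i s j t where eqs: "x = (i, s)" "y = (j, t)"
      by (cases x; cases y) blast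
    have "x \<otimes>\<^bsub>?D\<^esub> y = y \<otimes>\<^bsub>?D\<^esub> x"
      using that(3)
    proof (elim disjE)
      assume "\<not> snd x \<and> \<not> snd y"
      then show ?thesis by (simp add: eqs mult_dihedral_model add.commute)
    qed (simp_all add: eqs mult_dihedral_model)
    with that(1,2) show ?thesis by blast
  qed
  have same_ord: "D.ord x = D.ord y"
    if "x \<in> carrier ?D" "y \<in> carrier ?D" "snd x" "snd y" for x y
    using ord2[OF that(1)] ord2[OF that(2)] that(3,4) by simp
  have apart: "x' \<otimes>\<^bsub>?D\<^esub> y' \<noteq> y' \<otimes>\<^bsub>?D\<^esub> x'"
    if mem: "x' \<in> carrier ?D" "y' \<in> carrier ?D" and s: "x' \<noteq> (0, False)" "\<not> snd x'" "snd y'" for x' y'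
  proof
    assume eq: "x' \<otimes>\<^bsub>?D\<^esub> y' = y' \<otimes>\<^bsub>?D\<^esub> x'"
    obtain i j where ij: "x' = (i, False)" "y' = (j, True)"
      using s by (cases x'; cases y') auto
    with eq have "(i + j) mod int n = (j - i) mod int n"
      by (simp add: mult_dihedral_model)
    then have "((i + j) - (j - i)) mod int n = 0"
      by (simp add: mod_eq_dvd_iff)
    then have "(i + i) mod int n = 0"
      by simp
    with double_mod_odd_eq_0[OF assms, of i] mem s ij show False
      by (auto simp: carrier_dihedral_model)
  qed
  \<comment> \<open>The order tells the identity, the nontrivial rotations and the reflections apart.\<close>
  have kind: "x' \<noteq> (0, False) \<and> snd x' = snd x"
    if "x' \<in> carrier ?D" "x \<in> carrier ?D" "D.ord x' = D.ord x" "x \<noteq> (0, False)" for x x'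
    using ord1[OF that(1)] ord1[OF that(2)] ord2[OF that(1)] ord2[OF that(2)] that(3,4) by simp
  have adj: "(D.ord x = D.ord y \<or> (\<exists>x'\<in>carrier ?D. \<exists>y'\<in>carrier ?D. D.ord x' = D.ord x \<and> D.ord y' = D.ord y \<and>
      x' \<otimes>\<^bsub>?D\<^esub> y' = y' \<otimes>\<^bsub>?D\<^esub> x')) \<longleftrightarrow> x = (0, False) \<or> y = (0, False) \<or> snd x = snd y" (is "?L \<longleftrightarrow> ?R")
    if xy: "x \<in> carrier ?D" "y \<in> carrier ?D" for x y
  proof
    assume ?L
    then show ?R
    proof
      assume "D.ord x = D.ord y"
      then show ?R using ord2[OF xy(1)] ord2[OF xy(2)] by simp
    next
      assume "\<exists>x'\<in>carrier ?D. \<exists>y'\<in>carrier ?D. D.ord x' = D.ord x \<and> D.ord y' = D.ord y \<and>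
        x' \<otimes>\<^bsub>?D\<^esub> y' = y' \<otimes>\<^bsub>?D\<^esub> x'"
      then obtain x' y' where mem: "x' \<in> carrier ?D" "y' \<in> carrier ?D"
        and ords: "D.ord x' = D.ord x" "D.ord y' = D.ord y"
        and comm: "x' \<otimes>\<^bsub>?D\<^esub> y' = y' \<otimes>\<^bsub>?D\<^esub> x'"
        by blast
      show ?R
      proof (rule ccontr)
        assume no: "\<not> ?R"
        then have "x' \<noteq> (0, False)" "snd x' = snd x" "y' \<noteq> (0, False)" "snd y' = snd y"
          using kind[OF mem(1) xy(1) ords(1)] kind[OF mem(2) xy(2) ords(2)] by auto
        then show False
          using no comm apart[OF mem] apart[OF mem(2,1)] by (cases "snd x") auto
      qed
    qed
  next
    assume ?R
    then show ?L using comm_same[OF xy] same_ord[OF xy] by blast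
  qed
  show ?thesis
  proof (rule Set.set_eqI)
    fix p :: "(int \<times> bool) \<times> (int \<times> bool)"
    obtain x y where p: "p = (x, y)" by (cases p)
    have "(x, y) \<in> parcs (OSCom ?D) \<longleftrightarrow>
        x \<in> carrier ?D \<and> y \<in> carrier ?D \<and> x \<noteq> y \<and> (x = (0, False) \<or> y = (0, False) \<or> snd x = snd y)"
      unfolding OSCom_def using adj[of x y]
      by (simp only: pair_pre_digraph.simps mem_Collect_eq case_prod_conv cong: conj_cong)
    then show "p \<in> parcs (OSCom ?D) \<longleftrightarrow> p \<in> {(x, y). x \<in> carrier ?D \<and> y \<in> carrier ?D \<and> x \<noteq> y \<and>
        (x = (0, False) \<or> y = (0, False) \<or> snd x = snd y)}"
      unfolding p mem_Collect_eq case_prod_conv .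
  qed
qed

section \<open>The order super commuting graph of a dihedral group\<close>

lemma OSCom_dihedral_group_iso_model:
  assumes "n > 0"
  shows "digraph_iso (with_proj (OSCom (dihedral_group n))) (with_proj (OSCom (dihedral_model n)))"
proof -
  obtain h where "h \<in> iso (dihedral_model n) (dihedral_group n)"
    using dihedral_group_iso_model[OF assms] by blast
  then have "inv_into (carrier (dihedral_model n)) h \<in> iso (dihedral_group n) (dihedral_model n)"
    using group.iso_set_sym group_dihedral_model[OF assms] by blast
  then show ?thesis
    by (intro OSCom_iso group_dihedral_model[OF assms])
      (simp add: dihedral_group_def group_presented_group)
qed

lemma OSCom_dihedral_group_even:
  assumes "n > 0" "even n"
  shows "digraph_iso (with_proj (OSCom (dihedral_group n))) (with_proj (complete_graph (2 * n)))"
proof -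
  have "pverts (OSCom (dihedral_model n)) = {0..<int n} \<times> UNIV"
    by (simp add: OSCom_def carrier_dihedral_model)
  then have "digraph_iso (with_proj (OSCom (dihedral_model n))) (with_proj (complete_graph (2 * n)))"
    by (intro digraph_iso_complete_graph)
      (simp_all add: OSCom_dihedral_model_even[OF assms] carrier_dihedral_model card_cartesian_product)
  with OSCom_dihedral_group_iso_model[OF assms(1)] show ?thesis
    by (rule digraph_iso_trans)
qed

text \<open>
  The identity goes to \<open>K\<^sub>1\<close>, the nontrivial rotations go to \<open>K\<close> on \<open>n - 1\<close> vertices (whose
  numbering starts at 0, hence the shift), and the reflections go to \<open>K\<close> on \<open>n\<close> vertices.
\<close>

fun odd_vertex :: "int \<times> bool \<Rightarrow> nat + (nat + nat)" where
  "odd_vertex (i, s) =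
    (if s then Inr (Inr (nat i)) else if i = 0 then Inl 0 else Inr (Inl (nat i - 1)))"

lemma OSCom_dihedral_group_odd:
  assumes "odd n"
  shows "digraph_iso (with_proj (OSCom (dihedral_group n)))
    (with_proj (join_graph (complete_graph 1)
      (disjoint_union_graph (complete_graph (n - 1)) (complete_graph n))))"
proof -
  let ?V = "{0..<int n} \<times> (UNIV :: bool set)"
  let ?H = "join_graph (complete_graph 1)
      (disjoint_union_graph (complete_graph (n - 1)) (complete_graph n))"
  have n: "n > 0" using assms by (simp add: odd_pos)
  have V: "pverts (OSCom (dihedral_model n)) = ?V"
    by (simp add: OSCom_def carrier_dihedral_model)
  have W: "pverts ?H = {..<1} <+> ({..<n - 1} <+> {..<n})"
    by (simp add: pverts_graph_simps)
  have inj: "inj_on odd_vertex ?V"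
    by (rule inj_onI) (auto split: if_splits)
  \<comment> \<open>Both sides have \<open>2 * n\<close> vertices, so an injection into the target is onto.\<close>
  have "odd_vertex ` ?V \<subseteq> pverts ?H"
    unfolding W using n by (auto simp: Plus_def)
  moreover have "card (pverts ?H) = card (odd_vertex ` ?V)"
    unfolding W card_image[OF inj] using n by (simp add: card_Plus card_cartesian_product)
  moreover have "finite (pverts ?H)"
    unfolding W by simp
  ultimately have "odd_vertex ` ?V = pverts ?H"
    by (simp add: card_subset_eq)
  with inj have bij: "bij_betw odd_vertex (pverts (OSCom (dihedral_model n))) (pverts ?H)"
    by (simp add: V bij_betw_def)
  have "digraph_iso (with_proj (OSCom (dihedral_model n))) (with_proj ?H)"
  proof (rule digraph_iso_pairI[OF bij])
    fix x y assume xy: "x \<in> pverts (OSCom (dihedral_model n))" "y \<in> pverts (OSCom (dihedral_model n))"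
    obtain i s j t where eqs: "x = (i, s)" "y = (j, t)"
      by (cases x; cases y) blast
    have bounds: "0 \<le> i" "i < int n" "0 \<le> j" "j < int n"
      using xy by (auto simp: V eqs)
    have arcs: "(x, y) \<in> parcs (OSCom (dihedral_model n)) \<longleftrightarrow>
        x \<noteq> y \<and> (x = (0, False) \<or> y = (0, False) \<or> s = t)"
      using xy by (simp add: OSCom_dihedral_model_odd[OF assms] V carrier_dihedral_model eqs)
    consider "s" "t" | "s" "\<not> t" | "\<not> s" "t" | "\<not> s" "\<not> t"
      by blast
    then show "(x, y) \<in> parcs (OSCom (dihedral_model n)) \<longleftrightarrow> (odd_vertex x, odd_vertex y) \<in> parcs ?H"
      unfolding arcs using bounds
      by cases (auto simp: eqs parcs_graph_simps pverts_graph_simps)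
  next
    show "parcs (OSCom (dihedral_model n)) \<subseteq>
        pverts (OSCom (dihedral_model n)) \<times> pverts (OSCom (dihedral_model n))"
      by (auto simp: OSCom_def)
    show "parcs ?H \<subseteq> pverts ?H \<times> pverts ?H"
      unfolding join_graph_def disjoint_union_graph_def complete_graph_def by auto
  qed
  with OSCom_dihedral_group_iso_model[OF n] show ?thesis
    by (rule digraph_iso_trans)
qed

theorem theorem2p10:
  fixes n :: nat
  assumes "n \<ge> 3"
  shows "(even n \<longrightarrow>
            digraph_iso (with_proj (OSCom (dihedral_group n))) (with_proj (complete_graph (2 * n)))) \<and>
         (odd n \<longrightarrow>
            digraph_iso (with_proj (OSCom (dihedral_group n)))
              (with_proj (join_graph (complete_graph 1)
                (disjoint_union_graph (complete_graph (n - 1)) (complete_graph n)))))"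
  using assms OSCom_dihedral_group_even OSCom_dihedral_group_odd by simp

end
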